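(* There is no Borel probability measure on $[0,1]$ which is simultaneously invariant and ergodic with respect to the one-sided shift transformation $T$ on the $\bar O^2$-expansion and absolutely continuous with respect to Lebesgue measure.
   Context: $\mathbb N=\{1,2,3,\dots\}$. Every irrational $x\in(0,1)$ has a unique expansion $x=\sum_{n\ge1}\frac{(-1)^{n-1}}{q_n}$ with positive integers $q_n$ satisfying $q_{n+1}\ge q_n(q_n+1)$ for all $n$ (second Ostrogradsky series). Its $\bar O^2$-symbols are $d_1(x)=q_1$ and $d_{k+1}(x)=q_{k+1}-q_k(q_k+1)+1\in\mathbb N$ for $k\ge1$; one writes $x=\bar O^2(d_1(x),d_2(x),\dots)$. The map $x\mapsto(d_k(x))_{k\ge1}$ is a bijection from the irrationals in $(0,1)$ onto $\mathbb N^{\mathbb N}$. The one-sided shift is $T(\bar O^2(d_1,d_2,d_3,\dots))=\bar O^2(d_2,d_3,\dots)$ for irrational $x\in(0,1)$; on the countable set of rationals in $[0,1]$, $T$ may be defined arbitrarily. A measure $\mu$ is invariant with respect to $T$ if $\mu(T^{-1}E)=\mu(E)$ for every Borel set $E$; it is ergodic with respect to $T$ if every Borel set $A$ with $T^{-1}A=A$ has either zero or full $\mu$-measure. *)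

theory Defs
  imports "HOL-Probability.Probability"
begin

(* Sequences are indexed from 0: q n, d n below stand for q_{n+1}, d_{n+1}
   of the usual notation, so the sign (-1)^n is (-1)^{(n+1)-1}. *)

definition second_ostrogradsky_expansion :: "real \<Rightarrow> (nat \<Rightarrow> nat) \<Rightarrow> bool" where
  "second_ostrogradsky_expansion x q \<longleftrightarrow>
     (\<forall>n. q n > 0) \<and> (\<forall>n. q (Suc n) \<ge> q n * (q n + 1)) \<and>
     (\<lambda>n. (-1) ^ n / real (q n)) sums x"

(* The expansion exists and is unique for irrational x in (0,1), the only points
   at which the following two functions are used. *)
definition O2_denominators :: "real \<Rightarrow> nat \<Rightarrow> nat" where
  "O2_denominators x = (THE q. second_ostrogradsky_expansion x q)"

(* The truncated subtraction is exact since q_{k+1} >= q_k (q_k + 1). *)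
definition O2_symbol :: "real \<Rightarrow> nat \<Rightarrow> nat" where
  "O2_symbol x k =
     (case k of
        0 \<Rightarrow> O2_denominators x 0
      | Suc j \<Rightarrow> O2_denominators x (Suc j) + 1
                  - O2_denominators x j * (O2_denominators x j + 1))"

(* Inverse direction: q_1 = d_1 and q_{k+1} = q_k (q_k + 1) + d_{k+1} - 1;
   the subtraction is exact for symbols d_k >= 1. *)
primrec denominators_of_symbols :: "(nat \<Rightarrow> nat) \<Rightarrow> nat \<Rightarrow> nat" where
  "denominators_of_symbols d 0 = d 0"
| "denominators_of_symbols d (Suc k) =
     denominators_of_symbols d k * (denominators_of_symbols d k + 1) + d (Suc k) - 1"

definition O2_value :: "(nat \<Rightarrow> nat) \<Rightarrow> real" where
  "O2_value d = (\<Sum>n. (-1) ^ n / real (denominators_of_symbols d n))"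

(* T is a self-map of [0,1]; its values at rational points are left arbitrary. *)
definition is_O2_shift :: "(real \<Rightarrow> real) \<Rightarrow> bool" where
  "is_O2_shift T \<longleftrightarrow>
     T \<in> {0..1} \<rightarrow> {0..1} \<and>
     (\<forall>x\<in>{0<..<1} - \<rat>. T x = O2_value (\<lambda>k. O2_symbol x (Suc k)))"

(* Preimages are taken within the underlying space. *)
definition invariant_measure :: "'a measure \<Rightarrow> ('a \<Rightarrow> 'a) \<Rightarrow> bool" where
  "invariant_measure \<mu> T \<longleftrightarrow>
     (\<forall>E\<in>sets \<mu>. emeasure \<mu> (T -` E \<inter> space \<mu>) = emeasure \<mu> E)"

definition ergodic_measure :: "'a measure \<Rightarrow> ('a \<Rightarrow> 'a) \<Rightarrow> bool" where
  "ergodic_measure \<mu> T \<longleftrightarrow>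
     (\<forall>A\<in>sets \<mu>. T -` A \<inter> space \<mu> = A \<longrightarrow>
        emeasure \<mu> A = 0 \<or> emeasure \<mu> A = emeasure \<mu> (space \<mu>))"

end

theory Submission
  imports Defs
begin

text \<open>
  Each single symbol value is asymptotically negligible for Lebesgue measure, whereas under an
  invariant probability measure the frequency of a symbol value does not depend on the position.
  These two facts exclude absolute continuity.

  Write \<open>q\<^sub>0, q\<^sub>1, \<dots>\<close> for the denominators of an irrational \<open>x\<close> in the open unit interval. The tail
  \<open>1 / q\<^sub>0 - 1 / q\<^sub>1 + \<dots>\<close> lies strictly between \<open>1 / (q\<^sub>0 + 1)\<close> and \<open>1 / q\<^sub>0\<close>, so \<open>q\<^sub>0\<close> is the integer part
  of \<open>1 / x\<close>, and the next tail is \<open>G x = 1 / q\<^sub>0 - x\<close>. Thus \<open>q\<^sub>n\<close> is the integer part of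
  the reciprocal of \<open>(G ^^ n) x\<close>. This gives existence and uniqueness of the expansion
  (\<open>greedy_expansion\<close>, \<open>expansion_denominators\<close>) and measurability of the symbols. Sums of such
  expansions are irrational (\<open>expansion_irrational_unit\<close>), so the shift really acts on
  irrationals by dropping the first symbol.

  Between the unit fractions \<open>1 / (q + 1)\<close> and \<open>1 / q\<close>, \<open>G\<close> is a reflection onto the interval from \<open>0\<close>
  to \<open>1 / (q (q + 1))\<close>. Fixing a value \<open>c\<close> of the symbol after \<open>q\<close> pins the next denominator to a single number
  of size at least \<open>q (q + 1)\<close>, hence leaves a set of measure at most \<open>1 / (q (q + 1))\<^sup>2\<close>. Pulling
  this back along \<open>G\<close> and summing over \<open>q\<close> gains a factor \<open>1 / 2\<close> at every step
  (\<open>emeasure_symbol_event_le\<close>), so by the Borel-Cantelli lemma almost every \<open>x\<close> contains the symbol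
  \<open>c\<close> only finitely often (\<open>limsup_symbol_event_null\<close>).

  Let \<open>\<mu>\<close> be an invariant probability measure that is absolutely continuous. The event that the
  symbol at position \<open>n\<close> is \<open>c\<close> has the same \<open>\<mu>\<close>-measure for all \<open>n\<close>, so by Fatou's argument
  (\<open>emeasure_limsup_ge\<close>) it is bounded by the \<open>\<mu>\<close>-measure of the set on which \<open>c\<close> occurs infinitely often,
  which is \<open>0\<close>. Summing over \<open>c\<close> shows that the irrationals are \<open>\<mu>\<close>-null, and so are the
  rationals, a contradiction.
\<close>

section \<open>Tails of a second Ostrogradsky expansion\<close>

abbreviation irrational_unit :: "real set" where
  "irrational_unit \<equiv> {0<..<1} - \<rat>"

definition floor_recip :: "real \<Rightarrow> nat" where
  "floor_recip x = nat \<lfloor>1 / x\<rfloor>"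

text \<open>The map \<open>G\<close> from the introduction: since \<open>1 / x\<close> has integer part \<open>q\<^sub>0\<close>, it passes from an
  expansion to its tail.\<close>

definition remainder_map :: "real \<Rightarrow> real" where
  "remainder_map x = 1 / real (floor_recip x) - x"

lemma floor_recip_eq_iff:
  fixes x :: real
  assumes "0 < x" and "0 < q"
  shows "floor_recip x = q \<longleftrightarrow> 1 / (real q + 1) < x \<and> x \<le> 1 / real q"
proof -
  have "floor_recip x = q \<longleftrightarrow> \<lfloor>1 / x\<rfloor> = int q"
    using assms by (auto simp: floor_recip_def)
  also have "\<dots> \<longleftrightarrow> real q \<le> 1 / x \<and> 1 / x < real q + 1"
    by (simp add: floor_eq_iff)
  also have "\<dots> \<longleftrightarrow> 1 / (real q + 1) < x \<and> x \<le> 1 / real q"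
    using assms by (auto simp: field_simps)
  finally show ?thesis .
qed

lemma floor_recip_pos:
  assumes "0 < x" and "x \<le> 1"
  shows "0 < floor_recip x"
proof -
  have "1 \<le> 1 / x" using assms by simp
  then have "1 \<le> \<lfloor>1 / x\<rfloor>" by simp
  then show ?thesis by (simp add: floor_recip_def)
qed

lemma inverse_consecutive_diff:
  assumes "0 < (q::nat)"
  shows "1 / real q - 1 / (real q + 1) = 1 / (real q * (real q + 1))"
  using assms by (simp add: field_simps)

lemma inverse_le_consecutive_diff:
  fixes m k :: nat
  assumes "0 < m" and "m * (m + 1) \<le> k"
  shows "1 / real k \<le> 1 / real m - 1 / (real m + 1)"
proof -
  have "real m * (real m + 1) \<le> real k"
    using of_nat_mono[OF assms(2), where ?'a = real] by (simp add: algebra_simps)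
  moreover have "0 < real m * (real m + 1)"
    using assms(1) by simp
  ultimately show ?thesis
    unfolding inverse_consecutive_diff[OF assms(1)] by (simp add: frac_le)
qed

lemma irrational_unit_floor_recip:
  assumes "x \<in> irrational_unit"
  shows "0 < floor_recip x"
    and "1 / (real (floor_recip x) + 1) < x" and "x < 1 / real (floor_recip x)"
proof -
  show pos: "0 < floor_recip x"
    using assms floor_recip_pos[of x] by auto
  have *: "1 / (real (floor_recip x) + 1) < x" "x \<le> 1 / real (floor_recip x)"
    using assms pos floor_recip_eq_iff[of x "floor_recip x"] by auto
  have "x \<noteq> 1 / real (floor_recip x)"
    using assms by (metis DiffE Rats_1 Rats_divide Rats_of_nat)
  with * show "1 / (real (floor_recip x) + 1) < x" "x < 1 / real (floor_recip x)"
    by auto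
qed

lemma remainder_map_bounds:
  assumes "x \<in> irrational_unit"
  shows "remainder_map x \<in> irrational_unit"
    and "remainder_map x < 1 / (real (floor_recip x) * (real (floor_recip x) + 1))"
proof -
  let ?q = "floor_recip x"
  note b = irrational_unit_floor_recip[OF assms]
  show lt: "remainder_map x < 1 / (real ?q * (real ?q + 1))"
    using b inverse_consecutive_diff[OF b(1)] by (simp add: remainder_map_def)
  have "1 \<le> real ?q * (real ?q + 1)"
    using b(1) by (simp add: mult_ge1_I)
  then have "1 / (real ?q * (real ?q + 1)) \<le> 1"
    by simp
  moreover have "remainder_map x \<notin> \<rat>"
  proof
    assume "remainder_map x \<in> \<rat>"
    then have "1 / real ?q - remainder_map x \<in> \<rat>" by simp
    then show False using assms by (simp add: remainder_map_def)
  qed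
  moreover have "0 < remainder_map x"
    using b by (simp add: remainder_map_def)
  ultimately show "remainder_map x \<in> irrational_unit"
    using lt by simp
qed

text \<open>The growth condition on the denominators is automatic for the greedy choice: the remainder is
  below \<open>1 / q - 1 / (q + 1)\<close>.\<close>

lemma floor_recip_remainder_map_ge:
  assumes "x \<in> irrational_unit"
  shows "floor_recip x * (floor_recip x + 1) \<le> floor_recip (remainder_map x)"
proof -
  let ?m = "floor_recip x * (floor_recip x + 1)" and ?y = "remainder_map x"
  note b = irrational_unit_floor_recip[OF assms]
  have "0 < ?m" using b(1) by simp
  then have m: "0 < real ?m" by (simp only: of_nat_0_less_iff)
  have y: "0 < ?y"
    using remainder_map_bounds(1)[OF assms] by simp
  have "?y < 1 / real ?m"
    using remainder_map_bounds(2)[OF assms] by (simp add: algebra_simps)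
  then have "real ?m < 1 / ?y"
    using y m by (simp add: field_simps)
  then have "int ?m \<le> \<lfloor>1 / ?y\<rfloor>"
    by (simp only: le_floor_iff of_int_of_nat_eq less_imp_le)
  then show ?thesis
    unfolding floor_recip_def[of ?y] by (simp only: le_nat_iff)
qed

lemma denominators_ge_index:
  fixes q :: "nat \<Rightarrow> nat"
  assumes "\<And>n. 0 < q n" and "\<And>n. q n * (q n + 1) \<le> q (Suc n)"
  shows "n + 1 \<le> q n"
proof (induction n)
  case 0
  then show ?case using assms(1)[of 0] by simp
next
  case (Suc n)
  have "Suc n + 1 \<le> 1 * (q n + 1)" using Suc by simp
  also have "\<dots> \<le> q n * (q n + 1)"
    using assms(1)[of n] by (intro mult_le_mono1) simp
  also have "\<dots> \<le> q (Suc n)" by (rule assms(2))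
  finally show ?case .
qed

lemma inverse_denominators_Leibniz:
  fixes q :: "nat \<Rightarrow> nat"
  assumes "\<And>n. 0 < q n" and "\<And>n. q n * (q n + 1) \<le> q (Suc n)"
  shows "(\<lambda>n. 1 / real (q n)) \<longlonglongrightarrow> 0" and "1 / real (q (Suc n)) \<le> 1 / real (q n)"
proof -
  have ge: "n + 1 \<le> q n" for n
    using denominators_ge_index[of q] assms by blast
  show "(\<lambda>n. 1 / real (q n)) \<longlonglongrightarrow> 0"
  proof (rule real_tendsto_sandwich[OF _ _ tendsto_const LIMSEQ_inverse_real_of_nat])
    show "\<forall>\<^sub>F n in sequentially. 1 / real (q n) \<le> inverse (real (Suc n))"
    proof (intro always_eventually allI)
      fix n
      have "real (Suc n) \<le> real (q n)" using ge[of n] by simp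
      then show "1 / real (q n) \<le> inverse (real (Suc n))"
        by (simp add: inverse_eq_divide frac_le)
    qed
  qed simp
  have "q n * 1 \<le> q n * (q n + 1)" by (intro mult_le_mono2) simp
  then have "q n \<le> q (Suc n)" using assms(2)[of n] by linarith
  then show "1 / real (q (Suc n)) \<le> 1 / real (q n)"
    using assms(1)[of n] by (simp add: frac_le)
qed

lemma expansion_of_value:
  assumes "\<And>n. 0 < q n" and "\<And>n. q n * (q n + 1) \<le> q (Suc n)"
  shows "second_ostrogradsky_expansion (\<Sum>n. (-1) ^ n / real (q n)) q"
proof -
  have "summable (\<lambda>n. (-1) ^ n * (1 / real (q n)))"
    using inverse_denominators_Leibniz[of q] assms
    by (intro summable_Leibniz'(1)) auto
  then show ?thesis
    using assms by (simp add: second_ostrogradsky_expansion_def summable_sums)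
qed

lemma expansion_tail:
  assumes "second_ostrogradsky_expansion x q"
  shows "second_ostrogradsky_expansion (1 / real (q 0) - x) (\<lambda>n. q (Suc n))"
proof -
  have "(\<lambda>n. (-1) ^ n / real (q n)) sums x"
    using assms by (simp add: second_ostrogradsky_expansion_def)
  then have "(\<lambda>n. (-1) ^ Suc n / real (q (Suc n))) sums (x - 1 / real (q 0))"
    by (subst sums_Suc_iff) simp
  from sums_minus[OF this] show ?thesis
    using assms by (simp add: second_ostrogradsky_expansion_def)
qed

text \<open>An alternating series with decreasing terms is at least its two-term partial sum, and
  \<open>1 / q\<^sub>1\<close> is at most \<open>1 / q\<^sub>0 - 1 / (q\<^sub>0 + 1)\<close> by the growth condition.\<close>

lemma expansion_ge:
  assumes "second_ostrogradsky_expansion x q"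
  shows "1 / (real (q 0) + 1) \<le> x"
proof -
  have pos: "\<And>n. 0 < q n" and inc: "\<And>n. q n * (q n + 1) \<le> q (Suc n)"
    using assms by (auto simp: second_ostrogradsky_expansion_def)
  have "(\<Sum>i. (-1) ^ i * (1 / real (q i))) = x"
    using assms by (simp add: second_ostrogradsky_expansion_def sums_unique[symmetric])
  then have "(\<Sum>i<2 * 1. (-1) ^ i * (1 / real (q i))) \<le> x"
    using summable_Leibniz'(2)[of "\<lambda>n. 1 / real (q n)" 1] inverse_denominators_Leibniz[of q] pos inc
    by simp
  then have "1 / real (q 0) - 1 / real (q 1) \<le> x"
    by (simp add: numeral_2_eq_2)
  moreover have "1 / real (q 1) \<le> 1 / real (q 0) - 1 / (real (q 0) + 1)"
    using inverse_le_consecutive_diff[OF pos inc, of 0] by simp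
  ultimately show ?thesis by linarith
qed

text \<open>Positivity of the tail gives the strict upper bound; the strict upper bound for the tail
  improves the lower bound to a strict one.\<close>

lemma expansion_bounds:
  assumes "second_ostrogradsky_expansion x q"
  shows "1 / (real (q 0) + 1) < x" and "x < 1 / real (q 0)"
proof -
  have pos: "\<And>n. 0 < q n" and inc: "\<And>n. q n * (q n + 1) \<le> q (Suc n)"
    using assms by (auto simp: second_ostrogradsky_expansion_def)
  have upper: "y < 1 / real (r 0)" if "second_ostrogradsky_expansion y r" for y r
  proof -
    have "0 < 1 / (real (r 1) + 1)" by simp
    moreover have "1 / (real (r 1) + 1) \<le> 1 / real (r 0) - y"
      using expansion_ge[OF expansion_tail[OF that]] by simp
    ultimately show ?thesis by linarith
  qed
  show "x < 1 / real (q 0)" by (rule upper[OF assms])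
  have "1 / real (q 0) - x < 1 / real (q 1)"
    using upper[OF expansion_tail[OF assms]] by simp
  moreover have "1 / real (q 1) \<le> 1 / real (q 0) - 1 / (real (q 0) + 1)"
    using inverse_le_consecutive_diff[OF pos inc, of 0] by simp
  ultimately show "1 / (real (q 0) + 1) < x" by linarith
qed

lemma expansion_floor_recip:
  assumes "second_ostrogradsky_expansion x q"
  shows "floor_recip x = q 0"
proof -
  have "0 < q 0" using assms by (simp add: second_ostrogradsky_expansion_def)
  moreover have "0 < x"
    by (rule less_trans[OF _ expansion_bounds(1)[OF assms]]) simp
  ultimately show ?thesis
    using floor_recip_eq_iff[of x "q 0"] expansion_bounds[OF assms] by simp
qed

text \<open>This gives uniqueness: every denominator is recovered from \<open>x\<close> by iterating
  \<^const>\<open>remainder_map\<close>.\<close>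

lemma expansion_funpow:
  assumes "second_ostrogradsky_expansion x q"
  shows "second_ostrogradsky_expansion ((remainder_map ^^ n) x) (\<lambda>k. q (n + k))"
proof (induction n)
  case 0
  then show ?case using assms by simp
next
  case (Suc n)
  then show ?case
    using expansion_tail[OF Suc] expansion_floor_recip[OF Suc] by (simp add: remainder_map_def)
qed

lemma expansion_denominators:
  assumes "second_ostrogradsky_expansion x q"
  shows "O2_denominators x = q"
  unfolding O2_denominators_def
proof (rule the_equality[of _ q])
  fix r assume r: "second_ostrogradsky_expansion x r"
  show "r = q"
    using expansion_floor_recip[OF expansion_funpow[OF r]]
      expansion_floor_recip[OF expansion_funpow[OF assms]] by (metis add_0_right ext)
qed (fact assms)

text \<open>Infinite descent: if \<open>x = a / b\<close>, then the tail \<open>1 / q\<^sub>0 - x = (b - a q\<^sub>0) / (b q\<^sub>0)\<close> has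
  a numerator strictly between \<open>0\<close> and \<open>a\<close>, since \<open>a q\<^sub>0 < b < a (q\<^sub>0 + 1)\<close>.\<close>

lemma expansion_not_quotient:
  fixes a b :: int
  assumes "second_ostrogradsky_expansion x q" and "0 < a" and "0 < b"
  shows "x \<noteq> real_of_int a / real_of_int b"
  using assms
proof (induction "nat a" arbitrary: a b x q rule: less_induct)
  case less
  note b = expansion_bounds[OF less.prems(1)]
  have q: "0 < q 0"
    using less.prems(1) by (simp add: second_ostrogradsky_expansion_def)
  show ?case
  proof
    assume x: "x = real_of_int a / real_of_int b"
    have "real_of_int a * real (q 0) < real_of_int b"
      using b(2) less.prems q by (simp add: x field_simps)
    then have 1: "a * int (q 0) < b"
      by (metis of_int_less_iff of_int_mult of_int_of_nat_eq)
    have "real_of_int b < real_of_int a * (real (q 0) + 1)"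
      using b(1) less.prems q by (simp add: x field_simps)
    then have "real_of_int b < real_of_int (a * (int (q 0) + 1))"
      by simp
    then have 2: "b < a * (int (q 0) + 1)"
      by (simp only: of_int_less_iff)
    have "1 / real (q 0) - x \<noteq> real_of_int (b - a * int (q 0)) / real_of_int (b * int (q 0))"
      using less.hyps[OF _ expansion_tail[OF less.prems(1)], of "b - a * int (q 0)" "b * int (q 0)"]
        1 2 less.prems q by (simp add: algebra_simps)
    then show False
      using less.prems q by (simp add: x field_simps)
  qed
qed

lemma expansion_irrational_unit:
  assumes "second_ostrogradsky_expansion x q"
  shows "x \<in> irrational_unit"
proof -
  have q: "1 \<le> real (q 0)"
    using assms by (simp add: second_ostrogradsky_expansion_def Suc_le_eq)
  have pos: "0 < x"
    by (rule less_trans[OF _ expansion_bounds(1)[OF assms]]) simp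
  have "1 / real (q 0) \<le> 1" using q by simp
  then have "x < 1" using expansion_bounds(2)[OF assms] by linarith
  moreover have "x \<notin> \<rat>"
  proof
    assume "x \<in> \<rat>"
    then obtain a b :: int where ab: "0 < b" "x = real_of_int a / real_of_int b"
      by (rule Rats_cases') auto
    then have "0 < a" using pos by (simp add: zero_less_divide_iff)
    then show False using expansion_not_quotient[OF assms _ ab(1)] ab(2) by blast
  qed
  ultimately show ?thesis using pos by simp
qed

lemma funpow_remainder_map_irrational_unit:
  assumes "x \<in> irrational_unit"
  shows "(remainder_map ^^ n) x \<in> irrational_unit"
  using assms remainder_map_bounds(1) by (induction n) auto

text \<open>After \<open>n\<close> steps the error is exactly \<open>(G ^^ n) x\<close> up to sign, which is below \<open>1 / q\<^sub>n\<close>.\<close>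

lemma greedy_expansion:
  assumes "x \<in> irrational_unit"
  shows "second_ostrogradsky_expansion x (\<lambda>n. floor_recip ((remainder_map ^^ n) x))"
proof -
  define q where "q n = floor_recip ((remainder_map ^^ n) x)" for n
  note R = funpow_remainder_map_irrational_unit[OF assms]
  have pos: "0 < q n" for n
    using irrational_unit_floor_recip(1)[OF R] by (simp add: q_def)
  have inc: "q n * (q n + 1) \<le> q (Suc n)" for n
    using floor_recip_remainder_map_ge[OF R] by (simp add: q_def)
  have partial: "(\<Sum>k<n. (-1) ^ k / real (q k)) = x - (-1) ^ n * (remainder_map ^^ n) x" for n
  proof (induction n)
    case (Suc n)
    have "(remainder_map ^^ Suc n) x = 1 / real (q n) - (remainder_map ^^ n) x"
      by (simp add: remainder_map_def q_def)
    then have "(-1) ^ Suc n * (remainder_map ^^ Suc n) x =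
        (-1) ^ n * (remainder_map ^^ n) x - (-1) ^ n / real (q n)"
      by (simp only:) (simp add: algebra_simps)
    then show ?case using Suc by simp
  qed simp
  have "(\<lambda>n. (-1) ^ n * (remainder_map ^^ n) x) \<longlonglongrightarrow> 0"
  proof (rule Lim_null_comparison[OF _ inverse_denominators_Leibniz(1)[of q]])
    show "\<forall>\<^sub>F n in sequentially. norm ((-1) ^ n * (remainder_map ^^ n) x) \<le> 1 / real (q n)"
    proof (intro always_eventually allI)
      fix n
      have "0 < (remainder_map ^^ n) x" "(remainder_map ^^ n) x < 1 / real (q n)"
        using R[of n] irrational_unit_floor_recip(3)[OF R[of n]] by (simp_all add: q_def)
      then show "norm ((-1) ^ n * (remainder_map ^^ n) x) \<le> 1 / real (q n)"
        by (simp add: abs_mult power_abs)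
    qed
  qed (fact pos inc)+
  then have "(\<lambda>n. (-1) ^ n / real (q n)) sums x"
    using tendsto_diff[OF tendsto_const, of _ 0 sequentially x] by (simp add: sums_def partial)
  then have "second_ostrogradsky_expansion x q"
    using pos inc by (simp add: second_ostrogradsky_expansion_def)
  then show ?thesis by (simp add: q_def[abs_def])
qed

lemma O2_denominators_eq:
  assumes "x \<in> irrational_unit"
  shows "O2_denominators x n = floor_recip ((remainder_map ^^ n) x)"
  using expansion_denominators[OF greedy_expansion[OF assms]] by simp

section \<open>The symbols and the shift\<close>

lemma O2_symbol_Suc_eq:
  assumes "x \<in> irrational_unit"
  shows "O2_denominators x (Suc n) + 1 =
    O2_denominators x n * (O2_denominators x n + 1) + O2_symbol x (Suc n)"
    and "0 < O2_symbol x (Suc n)"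
proof -
  have "O2_denominators x n * (O2_denominators x n + 1) \<le> O2_denominators x (Suc n)"
    using greedy_expansion[OF assms]
    unfolding second_ostrogradsky_expansion_def O2_denominators_eq[OF assms] by blast
  then show "O2_denominators x (Suc n) + 1 =
      O2_denominators x n * (O2_denominators x n + 1) + O2_symbol x (Suc n)"
    and "0 < O2_symbol x (Suc n)"
    by (simp_all add: O2_symbol_def)
qed

text \<open>\<^const>\<open>remainder_map\<close> shifts the denominators. It differs from the shift on the symbols in the
  first symbol only: that of \<open>G x\<close> is the denominator \<open>q\<^sub>1\<close> itself, whereas a later symbol compares two
  consecutive denominators.\<close>

lemma O2_symbol_remainder_map:
  assumes "x \<in> irrational_unit"
  shows "O2_symbol (remainder_map x) (Suc n) = O2_symbol x (Suc (Suc n))"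
  using assms remainder_map_bounds(1)[OF assms]
  by (simp add: O2_symbol_def O2_denominators_eq funpow_swap1)

lemma
  assumes d: "\<And>n. 0 < d n"
  shows O2_value_irrational_unit: "O2_value d \<in> irrational_unit"
    and O2_symbol_O2_value: "O2_symbol (O2_value d) n = d n"
proof -
  let ?q = "denominators_of_symbols d"
  have step: "?q (Suc n) + 1 = ?q n * (?q n + 1) + d (Suc n)" for n
    using d[of "Suc n"] by simp
  have inc: "?q n * (?q n + 1) \<le> ?q (Suc n)" for n
    using step[of n] d[of "Suc n"] by linarith
  have pos: "0 < ?q n" for n
  proof (induction n)
    case (Suc n)
    then have "0 < ?q n * (?q n + 1)" by simp
    then show ?case using inc[of n] by linarith
  qed (simp add: d)
  have e: "second_ostrogradsky_expansion (O2_value d) ?q"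
    unfolding O2_value_def using pos inc by (rule expansion_of_value)
  show "O2_value d \<in> irrational_unit" by (rule expansion_irrational_unit[OF e])
  show "O2_symbol (O2_value d) n = d n"
    unfolding O2_symbol_def expansion_denominators[OF e]
    using step by (auto split: nat.split simp del: denominators_of_symbols.simps(2))
qed

lemma O2_shift_irrational_unit:
  assumes "is_O2_shift T" and "x \<in> irrational_unit"
  shows "T x \<in> irrational_unit" and "O2_symbol (T x) n = O2_symbol x (Suc n)"
proof -
  have T: "T x = O2_value (\<lambda>k. O2_symbol x (Suc k))"
    using assms by (simp add: is_O2_shift_def)
  show "T x \<in> irrational_unit" and "O2_symbol (T x) n = O2_symbol x (Suc n)"
    unfolding T using O2_symbol_Suc_eq(2)[OF assms(2)]
    by (rule O2_value_irrational_unit, rule O2_symbol_O2_value)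
qed

section \<open>Measurability of the symbols\<close>

definition symbol_event :: "nat \<Rightarrow> nat \<Rightarrow> real set" where
  "symbol_event n c = {x \<in> irrational_unit. O2_symbol x n = c}"

lemma measurable_floor_recip [measurable]: "floor_recip \<in> borel \<rightarrow>\<^sub>M count_space UNIV"
  unfolding floor_recip_def[abs_def] by measurable

lemma measurable_remainder_map [measurable]: "remainder_map \<in> borel \<rightarrow>\<^sub>M borel"
  unfolding remainder_map_def[abs_def] by measurable

lemma Rats_borel [measurable]: "(\<rat> :: real set) \<in> sets borel"
  by (rule sets.countable[OF _ countable_rat]) auto

text \<open>\<^const>\<open>O2_symbol\<close> is specified by a description operator, so its measurability is read off from
  the greedy formula, which is valid on irrationals.\<close>

lemma symbol_event_borel [measurable]: "symbol_event n c \<in> sets borel"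
proof -
  define q where "q n x = floor_recip ((remainder_map ^^ n) x)" for n x
  have [measurable]: "q n \<in> borel \<rightarrow>\<^sub>M count_space UNIV" for n
  proof -
    have [measurable]: "(remainder_map ^^ n) \<in> borel \<rightarrow>\<^sub>M borel"
      by (induction n) (simp_all add: measurable_comp[OF _ measurable_remainder_map])
    show ?thesis unfolding q_def[abs_def] by measurable
  qed
  define s where "s x = (case n of 0 \<Rightarrow> q 0 x | Suc j \<Rightarrow> q (Suc j) x + 1 - q j x * (q j x + 1))" for x
  have [measurable]: "s \<in> borel \<rightarrow>\<^sub>M count_space UNIV"
    unfolding s_def[abs_def] by (cases n) (simp_all, measurable)
  have "O2_symbol x n = s x" if "x \<in> irrational_unit" for x
    using that by (simp add: s_def q_def O2_symbol_def O2_denominators_eq split: nat.split)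
  then have "symbol_event n c = {x \<in> irrational_unit. s x = c}"
    unfolding symbol_event_def by (intro Collect_cong conj_cong refl) (simp only:)
  also have "\<dots> = irrational_unit \<inter> (s -` {c} \<inter> space borel)"
    by auto
  also have "\<dots> \<in> sets borel" by measurable
  finally show ?thesis .
qed

lemma symbol_event_Suc_Suc:
  "symbol_event (Suc (Suc n)) c = {x \<in> irrational_unit. remainder_map x \<in> symbol_event (Suc n) c}"
  unfolding symbol_event_def mem_Collect_eq
  by (intro Collect_cong conj_cong refl)
    (simp only: O2_symbol_remainder_map remainder_map_bounds(1) simp_thms)

text \<open>The two inclusions determine the preimage up to rational points, where the shift is
  unspecified.\<close>

lemma O2_shift_vimage_symbol_event:
  assumes "is_O2_shift T"
  shows "symbol_event (Suc n) c \<subseteq> T -` symbol_event n c"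
    and "T -` symbol_event n c \<inter> irrational_unit \<subseteq> symbol_event (Suc n) c"
  using O2_shift_irrational_unit[OF assms] by (auto simp: symbol_event_def)

section \<open>Lebesgue measure of the symbol events\<close>

lemma emeasure_lborel_reflect:
  fixes t :: real
  assumes [measurable]: "A \<in> sets borel"
  shows "emeasure lborel ((\<lambda>x. t - x) -` A) = emeasure lborel A"
proof -
  have "emeasure lborel A = emeasure (density (distr lborel borel (\<lambda>x. t + (-1) * x)) (\<lambda>_. ennreal \<bar>-1\<bar>)) A"
    using lborel_real_affine[of "-1" t] by simp
  also have "\<dots> = emeasure (distr lborel borel (\<lambda>x. t - x)) A"
    by (simp add: emeasure_density)
  also have "\<dots> = emeasure lborel ((\<lambda>x. t - x) -` A)"
    by (simp add: emeasure_distr)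
  finally show ?thesis ..
qed

text \<open>The series telescopes. Its terms dominate \<open>1 / (q (q + 1))\<^sup>2\<close> for \<open>q = N + i\<close>: one factor
  \<open>1 / (q (q + 1))\<close> is bounded by its value at \<open>N\<close>, the other is a difference of unit fractions.\<close>

lemma sums_inverse_square_product_majorant:
  fixes N :: nat
  assumes "0 < N"
  shows "(\<lambda>i. 1 / (real N * (real N + 1)) * (1 / real (N + i) - 1 / real (N + Suc i)))
      sums (1 / (real N ^ 2 * (real N + 1)))"
proof -
  have "(\<lambda>i. 1 / real (i + N)) \<longlonglongrightarrow> 0"
    by (rule LIMSEQ_ignore_initial_segment) (rule lim_1_over_n)
  then have "(\<lambda>i. 1 / real (N + i)) \<longlonglongrightarrow> 0" by (simp add: add.commute)
  from sums_mult[OF telescope_sums'[OF this], of "1 / (real N * (real N + 1))"]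
  show ?thesis by (simp add: power2_eq_square algebra_simps)
qed

text \<open>The inductive step of the decay estimate. The hypothesis on a block with index \<open>q\<close> is the
  conclusion with \<open>N = q (q + 1)\<close>, up to the factor \<open>1 / 2\<close>; that factor comes from
  \<open>1 / (N + 1) \<le> 1 / 2\<close>. A bound linear in \<open>1 / N\<close> would only reproduce itself, which is why
  the estimate is quadratic.\<close>

lemma emeasure_unit_fraction_blocks_le:
  fixes A :: "real set" and K :: real
  assumes [measurable]: "A \<in> sets borel" and K: "0 \<le> K" and N: "0 < N"
    and block: "\<And>q. N \<le> q \<Longrightarrow> emeasure lborel (A \<inter> {1 / (real q + 1)<..1 / real q})
        \<le> ennreal (K / (real q * (real q + 1)) ^ 2)"
  shows "emeasure lborel (A \<inter> {0<..1 / real N}) \<le> ennreal (K / 2 / real N ^ 2)"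
proof -
  define B where "B i = A \<inter> {1 / (real (N + i) + 1)<..1 / real (N + i)}" for i
  have [measurable]: "B i \<in> sets borel" for i by (simp add: B_def)
  have "A \<inter> {0<..1 / real N} \<subseteq> (\<Union>i. B i)"
  proof
    fix x assume x: "x \<in> A \<inter> {0<..1 / real N}"
    then have "real N \<le> 1 / x" using N by (auto simp: field_simps)
    then have "int N \<le> \<lfloor>1 / x\<rfloor>" by (simp add: le_floor_iff)
    then have ge: "N \<le> floor_recip x"
      unfolding floor_recip_def by linarith
    then have "x \<in> {1 / (real (floor_recip x) + 1)<..1 / real (floor_recip x)}"
      using x N floor_recip_eq_iff[of x "floor_recip x"] by auto
    then have "x \<in> B (floor_recip x - N)" using x ge by (simp add: B_def)
    then show "x \<in> (\<Union>i. B i)" by blast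
  qed
  then have "emeasure lborel (A \<inter> {0<..1 / real N}) \<le> emeasure lborel (\<Union>i. B i)"
    by (intro emeasure_mono) auto
  also have "\<dots> \<le> (\<Sum>i. emeasure lborel (B i))"
    by (rule emeasure_subadditive_countably) auto
  also have "\<dots> \<le> (\<Sum>i. ennreal (K * (1 / (real N * (real N + 1)) *
      (1 / real (N + i) - 1 / real (N + Suc i)))))"
  proof (intro suminf_le allI)
    fix i
    let ?q = "real (N + i)"
    define e where "e = 1 / real (N + i) - 1 / real (N + Suc i)"
    have e: "e = 1 / (?q * (?q + 1))"
      using inverse_consecutive_diff[of "N + i"] N by (simp add: e_def add.commute)
    have q: "0 < ?q" "real N \<le> ?q" using N by auto
    have "e \<le> 1 / (real N * (real N + 1))"
      unfolding e using q N by (intro divide_left_mono mult_mono mult_pos_pos) auto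
    moreover have "0 \<le> e" unfolding e using q by simp
    ultimately have "K * (e * e) \<le> K * (1 / (real N * (real N + 1)) * e)"
      using K by (intro mult_left_mono mult_right_mono)
    moreover have "K * (e * e) = K / (?q * (?q + 1)) ^ 2"
      by (simp add: e power2_eq_square)
    ultimately show "emeasure lborel (B i) \<le> ennreal (K * (1 / (real N * (real N + 1)) *
        (1 / real (N + i) - 1 / real (N + Suc i))))"
      using block[of "N + i"] unfolding B_def e_def[symmetric]
      by (auto intro: order_trans ennreal_leI)
  qed auto
  also have "\<dots> = ennreal (K * (1 / (real N ^ 2 * (real N + 1))))"
  proof (rule suminf_ennreal_eq)
    fix i show "0 \<le> K * (1 / (real N * (real N + 1)) * (1 / real (N + i) - 1 / real (N + Suc i)))"
      using K N by (intro mult_nonneg_nonneg) (auto simp: frac_le)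
  qed (rule sums_mult[OF sums_inverse_square_product_majorant[OF N]])
  also have "\<dots> \<le> ennreal (K / 2 / real N ^ 2)"
  proof (rule ennreal_leI)
    have "1 / (real N ^ 2 * (real N + 1)) \<le> 1 / (real N ^ 2 * 2)"
      using N by (intro divide_left_mono mult_left_mono) auto
    from mult_left_mono[OF this K] show "K * (1 / (real N ^ 2 * (real N + 1))) \<le> K / 2 / real N ^ 2"
      by (simp add: field_simps)
  qed
  finally show ?thesis .
qed

text \<open>Restricting to \<open>x \<le> 1 / N\<close> makes the induction work: \<^const>\<open>remainder_map\<close> reflects the block between
  \<open>1 / (q + 1)\<close> and \<open>1 / q\<close> onto the interval between \<open>0\<close> and \<open>1 / (q (q + 1))\<close>, which is again of this form.\<close>

lemma emeasure_symbol_event_le: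
  assumes "0 < N"
  shows "emeasure lborel (symbol_event (Suc n) c \<inter> {0<..1 / real N}) \<le> ennreal (1 / 2 ^ Suc n / real N ^ 2)"
  using assms
proof (induction n arbitrary: N)
  case 0
  have "emeasure lborel (symbol_event 1 c \<inter> {0<..1 / real N}) \<le> ennreal (1 / 2 / real N ^ 2)"
  proof (rule emeasure_unit_fraction_blocks_le)
    fix q assume "N \<le> q"
    then have q: "0 < q" using 0 by simp
    \<comment> \<open>the only possible second denominator when the first one is \<open>q\<close>\<close>
    define m where "m = q * (q + 1) + c - 1"
    show "emeasure lborel (symbol_event 1 c \<inter> {1 / (real q + 1)<..1 / real q})
        \<le> ennreal (1 / (real q * (real q + 1)) ^ 2)"
    proof (cases "c = 0")
      case True
      then have "symbol_event 1 c = {}"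
        using O2_symbol_Suc_eq(2)[of _ 0] by (force simp del: Diff_iff simp: symbol_event_def)
      then show ?thesis by simp
    next
      case False
      have m: "q * (q + 1) \<le> m" "0 < q * (q + 1)"
        using False q by (simp_all add: m_def)
      then have m0: "0 < m" by linarith
      have m_real: "real q * (real q + 1) \<le> real m" "0 < real q * (real q + 1)"
        using of_nat_mono[OF m(1), where ?'a = real] q by (simp_all add: algebra_simps add_pos_pos)
      have "symbol_event 1 c \<inter> {1 / (real q + 1)<..1 / real q}
          \<subseteq> {1 / real q - 1 / real m..1 / real q - 1 / (real m + 1)}"
      proof
        fix x assume x: "x \<in> symbol_event 1 c \<inter> {1 / (real q + 1)<..1 / real q}"
        then have I: "x \<in> irrational_unit" and s: "O2_symbol x (Suc 0) = c"
          by (auto simp: symbol_event_def)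
        have fx: "floor_recip x = q"
          using x I q floor_recip_eq_iff[of x q] by auto
        then have "floor_recip (remainder_map x) = m"
          using O2_symbol_Suc_eq(1)[OF I, of 0] s by (simp add: O2_denominators_eq[OF I] m_def)
        then have "1 / (real m + 1) < remainder_map x" "remainder_map x \<le> 1 / real m"
          using floor_recip_eq_iff[of "remainder_map x" m] m0 remainder_map_bounds(1)[OF I] by auto
        then show "x \<in> {1 / real q - 1 / real m..1 / real q - 1 / (real m + 1)}"
          by (simp add: remainder_map_def fx)
      qed
      then have "emeasure lborel (symbol_event 1 c \<inter> {1 / (real q + 1)<..1 / real q})
          \<le> emeasure lborel {1 / real q - 1 / real m..1 / real q - 1 / (real m + 1)}"
        by (intro emeasure_mono) auto
      also have "\<dots> = ennreal (1 / real m - 1 / (real m + 1))"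
        using m0 by (subst emeasure_lborel_Icc) (auto intro: divide_left_mono)
      also have "\<dots> \<le> ennreal (1 / (real q * (real q + 1)) ^ 2)"
        unfolding inverse_consecutive_diff[OF m0] power2_eq_square using m_real m0 q
        by (intro ennreal_leI divide_left_mono mult_mono mult_pos_pos) auto
      finally show ?thesis .
    qed
  qed (use 0 in auto)
  then show ?case by simp
next
  case (Suc n)
  have "emeasure lborel (symbol_event (Suc (Suc n)) c \<inter> {0<..1 / real N})
      \<le> ennreal (1 / 2 ^ Suc n / 2 / real N ^ 2)"
  proof (rule emeasure_unit_fraction_blocks_le)
    fix q assume "N \<le> q"
    then have q: "0 < q" using Suc.prems by simp
    let ?A = "symbol_event (Suc n) c \<inter> {0<..1 / real (q * (q + 1))}"
    have "symbol_event (Suc (Suc n)) c \<inter> {1 / (real q + 1)<..1 / real q}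
        \<subseteq> (\<lambda>x. 1 / real q - x) -` ?A"
    proof
      fix x assume x: "x \<in> symbol_event (Suc (Suc n)) c \<inter> {1 / (real q + 1)<..1 / real q}"
      then have I: "x \<in> irrational_unit" and r: "remainder_map x \<in> symbol_event (Suc n) c"
        by (auto simp: symbol_event_Suc_Suc)
      have fx: "floor_recip x = q"
        using x I q floor_recip_eq_iff[of x q] by auto
      show "x \<in> (\<lambda>x. 1 / real q - x) -` ?A"
        using r remainder_map_bounds[OF I] by (simp add: fx remainder_map_def algebra_simps)
    qed
    then have "emeasure lborel (symbol_event (Suc (Suc n)) c \<inter> {1 / (real q + 1)<..1 / real q})
        \<le> emeasure lborel ((\<lambda>x. 1 / real q - x) -` ?A)"
      by (intro emeasure_mono) (auto intro!: measurable_sets_borel[of _ borel])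
    also have "\<dots> = emeasure lborel ?A"
      by (rule emeasure_lborel_reflect) measurable
    also have "\<dots> \<le> ennreal (1 / 2 ^ Suc n / real (q * (q + 1)) ^ 2)"
      using q by (intro Suc.IH) simp
    also have "real (q * (q + 1)) = real q * (real q + 1)" by (simp add: algebra_simps)
    finally show "emeasure lborel (symbol_event (Suc (Suc n)) c \<inter> {1 / (real q + 1)<..1 / real q})
        \<le> ennreal (1 / 2 ^ Suc n / (real q * (real q + 1)) ^ 2)" .
  qed (use Suc.prems in auto)
  then show ?case by (simp add: mult.commute)
qed

lemma limsup_symbol_event_null:
  "limsup (\<lambda>n. symbol_event (Suc n) c) \<in> null_sets lborel"
proof (rule borel_cantelli_limsup1)
  have bound: "emeasure lborel (symbol_event (Suc n) c) \<le> ennreal ((1 / 2) ^ Suc n)" for n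
  proof -
    have "symbol_event (Suc n) c = symbol_event (Suc n) c \<inter> {0<..1 / real 1}"
      by (auto simp: symbol_event_def)
    then show ?thesis
      using emeasure_symbol_event_le[of 1 n c] by (simp add: power_one_over)
  qed
  show "emeasure lborel (symbol_event (Suc n) c) < \<infinity>" for n
    using bound[of n] by (rule order.strict_trans1) simp
  show "summable (\<lambda>n. measure lborel (symbol_event (Suc n) c))"
  proof (rule summable_comparison_test')
    show "summable (\<lambda>n. (1 / 2 :: real) ^ Suc n)"
      by (simp only: summable_Suc_iff) (rule summable_geometric, simp)
    show "norm (measure lborel (symbol_event (Suc n) c)) \<le> (1 / 2) ^ Suc n" if "0 \<le> n" for n
      using enn2real_leI[OF _ bound[of n]] by (simp add: measure_def del: power_Suc)
  qed
qed simp

section \<open>Invariance contradicts the decay of the symbol events\<close>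

lemma (in finite_measure) emeasure_limsup_ge:
  assumes [measurable]: "\<And>n. A n \<in> sets M" and ge: "\<And>n. p \<le> emeasure M (A n)"
  shows "p \<le> emeasure M (limsup A)"
proof -
  let ?B = "\<lambda>n. \<Union>m\<in>{n..}. A m"
  have "p \<le> (INF n. emeasure M (?B n))"
    by (intro INF_greatest order_trans[OF ge] emeasure_mono) auto
  also have "\<dots> = emeasure M (\<Inter>n. ?B n)"
  proof (rule INF_emeasure_decseq)
    show "decseq ?B" by (intro antimonoI UN_mono) auto
  qed auto
  finally show ?thesis by (simp add: limsup_INF_SUP)
qed

theorem theorem2:
  fixes T :: "real \<Rightarrow> real"
  assumes "is_O2_shift T"
  shows "\<not> (\<exists>\<mu> :: real measure.
           sets \<mu> = sets (restrict_space borel {0..1}) \<and>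
           prob_space \<mu> \<and>
           invariant_measure \<mu> T \<and>
           ergodic_measure \<mu> T \<and>
           absolutely_continuous (restrict_space lborel {0..1}) \<mu>)"
proof (rule notI, elim exE conjE)
  fix \<mu> :: "real measure"
  assume sets: "sets \<mu> = sets (restrict_space borel {0..1})" and "prob_space \<mu>"
    and inv: "invariant_measure \<mu> T"
    and ac: "absolutely_continuous (restrict_space lborel {0..1}) \<mu>"
  interpret prob_space \<mu> by fact
  have sp: "space \<mu> = {0..1}"
    using sets_eq_imp_space_eq[OF sets] by (simp add: space_restrict_space)
  have sets_iff: "A \<in> sets \<mu> \<longleftrightarrow> A \<in> sets borel \<and> A \<subseteq> {0..1}" for A
    unfolding sets by (auto simp: sets_restrict_space_iff)
  have null: "A \<in> null_sets \<mu>" if "A \<in> null_sets lborel" "A \<subseteq> {0..1}" for A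
    using ac that by (auto simp: absolutely_continuous_def null_sets_restrict_space)
  have D [simp]: "symbol_event n c \<in> sets \<mu>" for n c
    by (auto simp: sets_iff symbol_event_borel) (auto simp: symbol_event_def)

  have step: "emeasure \<mu> (symbol_event (Suc n) c) = emeasure \<mu> (symbol_event n c)" for n c
  proof -
    \<comment> \<open>the part of the preimage about which the assumption on \<open>T\<close> says nothing\<close>
    define Z where "Z = (T -` symbol_event n c \<inter> {0..1}) \<inter> \<rat>"
    have "countable Z"
      unfolding Z_def using countable_rat by (rule countable_subset[rotated]) auto
    then have Z: "Z \<in> null_sets \<mu>"
      by (intro null countable_imp_null_set_lborel) (auto simp: Z_def)
    have "{0..1} \<subseteq> irrational_unit \<union> \<rat>"
      using Rats_0 Rats_1 by (auto simp: less_le simp del: Rats_0 Rats_1)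
    then have "T -` symbol_event n c \<inter> space \<mu> = symbol_event (Suc n) c \<union> Z"
      using O2_shift_vimage_symbol_event[OF assms, of n c]
      by (auto simp: sp Z_def) (auto simp: symbol_event_def)
    moreover have "emeasure \<mu> (T -` symbol_event n c \<inter> space \<mu>) = emeasure \<mu> (symbol_event n c)"
      using inv D by (simp only: invariant_measure_def)
    ultimately show ?thesis
      using emeasure_Un_null_set[OF D Z, of "Suc n" c] by simp
  qed
  have stationary: "emeasure \<mu> (symbol_event n c) = emeasure \<mu> (symbol_event 0 c)" for n c
    by (induction n) (simp_all add: step)

  have "emeasure \<mu> (symbol_event 0 c) = 0" for c
  proof -
    let ?L = "limsup (\<lambda>n. symbol_event (Suc n) c)"
    have "?L \<subseteq> {0..1}"
      by (auto simp: limsup_INF_SUP symbol_event_def)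
    then have "emeasure \<mu> ?L = 0"
      using null[OF limsup_symbol_event_null] by (simp add: null_sets_def)
    moreover have "emeasure \<mu> (symbol_event 0 c) \<le> emeasure \<mu> ?L"
      by (rule emeasure_limsup_ge, rule D, rule eq_refl, rule stationary[symmetric])
    ultimately show ?thesis by simp
  qed
  then have "(\<Union>c. symbol_event 0 c) \<in> null_sets \<mu>"
    by (intro null_sets_UN) (simp add: null_sets_def)
  moreover have "{0..1} \<inter> \<rat> \<in> null_sets \<mu>"
    by (intro null countable_imp_null_set_lborel countable_Int2 countable_rat) auto
  ultimately have "(\<Union>c. symbol_event 0 c) \<union> ({0..1} \<inter> \<rat>) \<in> null_sets \<mu>"
    by (rule null_sets.Un)
  moreover have "(\<Union>c. symbol_event 0 c) \<union> ({0..1} \<inter> \<rat>) = space \<mu>"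
    by (auto simp: symbol_event_def sp less_le)
  ultimately show False
    using emeasure_space_1 by (simp add: null_sets_def)
qed

end
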